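(* Let $a,b\in\mathbb{R}$ with $a>|b|$ and let $k\in\mathbb{N}$ be fixed. Let $\alpha_r^4(L,U)=\alpha_r^4(L,U,k;a,b)$, $r=0,1,\dots,k$, and $\beta_r^4(L,U)=\beta_r^4(L,U,k)$, $r=1,\dots,k$, be control functions, defined for integers $L>\frac{1}{2\pi}T_0$ and $U\in(0,\pi)$, of the metamorphoses $$\prod_{r=1}^k\left|\frac{\sum_{n\le\tau(\alpha_r^4)}\frac{2}{\sqrt n}\cos\{\alpha_r^4\omega_n(\alpha_r^4)+\psi(\alpha_r^4)\}+R(\alpha_r^4)}{\sum_{n\le\tau(\beta_r^4)}\frac{2}{\sqrt n}\cos\{\beta_r^4\omega_n(\beta_r^4)+\psi(\beta_r^4)\}+R(\beta_r^4)}\right|^2\sim\frac{\arctan\left(\sqrt{\frac{a-b}{a+b}}\tan\frac U2\right)}{\sqrt{\frac{a-b}{a+b}}\,\frac U2}\cdot\frac{a+b\cos(\alpha_0^4)}{a+b},\qquad L\to\infty .$$ Then there is an infinite set of distinct metamorphoses of this form; that is, the set of control tuples $$\left(\alpha_0^4(L,U),\alpha_1^4(L,U),\dots,\alpha_k^4(L,U),\beta_1^4(L,U),\dots,\beta_k^4(L,U)\right),$$ where $L$ ranges over the integers $>\frac{1}{2\pi}T_0$ and $U$ over $(0,\pi)$, is infinite.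
   Context: $\zeta$ is the Riemann zeta-function and $Z(t)=e^{i\vartheta(t)}\zeta\left(\frac12+it\right)$ is the Riemann–Siegel (Hardy) function, so $|Z(t)|=\left|\zeta\left(\frac12+it\right)\right|$. $c$ is Euler's constant and $\pi(T)$ is the prime-counting function. The superscript $4$ is an index, not a power. Asymptotics as $L\to\infty$ are along integers $L$, with $a,b,k,U$ fixed. Riemann–Siegel notation: $\tau(x)=\sqrt{\frac{x}{2\pi}}$, $\omega_n(x)=\ln\frac{\tau(x)}{n}$, $\psi(x)=-\frac x2-\frac\pi8$, and $R(x)$ is the remainder in $$Z(x)=\sum_{n\le\tau(x)}\frac{2}{\sqrt n}\cos\{x\,\omega_n(x)+\psi(x)\}+R(x),\qquad R(x)=\mathcal{O}(x^{-1/4}).$$ Jacob's ladder: $\varphi_1(t)=\frac12\varphi(t)$, where $\varphi$ is a solution $x(T)=\varphi(T)$ of $$\int_0^{\mu[x(T)]}Z^2(t)e^{-\frac{2}{x(T)}t}\,dt=\int_0^TZ^2(t)\,dt,$$ with $\mu$ a fixed admissible function (smooth, increasing to $+\infty$), $\mu(y)\ge7y\ln y$. The function $\varphi_1$ is increasing for large arguments. Reverse iterates: for large $T$ put $T^{[0]}=T$ and define $T^{[r]}$ by $\varphi_1\left(T^{[r]}\right)=T^{[r-1]}$. Control functions: functions $\alpha_r^4$ ($0\le r\le k$), $\beta_r^4$ ($1\le r\le k$) of $(L,U)$, for integers $L>\frac{1}{2\pi}T_0$ with $T_0=T_0(a,b)$ sufficiently large and $U\in(0,\pi)$, none of whose values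 is an ordinate $\gamma$ of a zero $\zeta\left(\frac12+i\gamma\right)=0$, satisfying the displayed asymptotic relation in the claim, together with $2\pi L<\alpha_0^4<\dots<\alpha_k^4$, $2\pi L<\beta_1^4<\dots<\beta_k^4$, $\alpha_0^4\in(2\pi L,2\pi L+U)$, $\alpha_r^4,\beta_r^4\in\left((2\pi L)^{[r]},(2\pi L+U)^{[r]}\right)$ for $1\le r\le k$, and $\alpha_{r+1}^4-\alpha_r^4\sim(1-c)\pi(2\pi L)$ ($0\le r\le k-1$), $\beta_{r+1}^4-\beta_r^4\sim(1-c)\pi(2\pi L)$ ($1\le r\le k-1$) as $L\to\infty$. A metamorphosis is the instance of the displayed relation at the points $(\alpha_1^4,\dots,\alpha_k^4)$, $(\beta_1^4,\dots,\beta_k^4)$ controlled by $\alpha_0^4$; two metamorphoses are distinct if their control tuples are different. *)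

theory Defs
  imports
    "HOL-Complex_Analysis.Complex_Analysis"
    "HOL-Library.Landau_Symbols"
    "HOL-Computational_Algebra.Primes"
begin

unbundle asymp_equiv_syntax

text \<open>
  The analytic continuation of the Dirichlet series. By the identity theorem this determines
  the value at every point other than \<open>1\<close>; the value at the pole is unspecified.
\<close>
definition zeta :: "complex \<Rightarrow> complex" where
  "zeta = (SOME f. f holomorphic_on (- {1}) \<and>
             (\<forall>s. Re s > 1 \<longrightarrow> (\<lambda>n. of_nat (Suc n) powr (- s)) sums f s))"

text \<open>
  The library's complex \<open>ln_Gamma\<close> is the branch that is continuous off the nonpositive real axis
  and real on the positive real axis, as the Riemann--Siegel theta function requires.
\<close>
definition rs_theta :: "real \<Rightarrow> real" where
  "rs_theta t = Im (ln_Gamma (Complex (1/4) (t/2))) - t / 2 * ln pi"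

text \<open>The product below is real, so taking its real part only changes the type.\<close>
definition hardy_Z :: "real \<Rightarrow> real" where
  "hardy_Z t = Re (exp (\<i> * of_real (rs_theta t)) * zeta (Complex (1/2) t))"

definition rs_tau :: "real \<Rightarrow> real" where
  "rs_tau x = sqrt (x / (2 * pi))"

definition rs_omega :: "nat \<Rightarrow> real \<Rightarrow> real" where
  "rs_omega n x = ln (rs_tau x / real n)"

definition rs_psi :: "real \<Rightarrow> real" where
  "rs_psi x = - x / 2 - pi / 8"

definition rs_sum :: "real \<Rightarrow> real" where
  "rs_sum x = (\<Sum>n = 1..nat \<lfloor>rs_tau x\<rfloor>. 2 / sqrt (real n) * cos (x * rs_omega n x + rs_psi x))"

text \<open>
  The bound \<open>R(x) = O(x powr (-1/4))\<close> is a classical theorem about this function, not part of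
  its definition.
\<close>
definition rs_remainder :: "real \<Rightarrow> real" where
  "rs_remainder x = hardy_Z x - rs_sum x"

definition prime_count :: "real \<Rightarrow> real" where
  "prime_count x = real (card {p::nat. prime p \<and> real p \<le> x})"

definition admissible :: "real \<Rightarrow> (real \<Rightarrow> real) \<Rightarrow> bool" where
  "admissible y0 \<mu> \<longleftrightarrow>
     y0 > 0 \<and>
     (\<forall>n. (deriv ^^ n) \<mu> differentiable_on {y0<..}) \<and>
     mono_on {y0<..} \<mu> \<and>
     filterlim \<mu> at_top at_top \<and>
     (\<forall>y>y0. \<mu> y \<ge> 7 * y * ln y)"

text \<open>
  \<open>\<phi>\<close> solves the integral equation for all \<open>T \<ge> X0\<close>, with values in the domain
  \<open>{y0<..}\<close> of \<open>\<mu>\<close>. The left-hand side is strictly increasing in the unknown, so that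
  \<open>\<phi>\<close> is unique, continuous, strictly increasing and unbounded on \<open>{X0..}\<close>.
\<close>
definition jacob_ladder :: "real \<Rightarrow> (real \<Rightarrow> real) \<Rightarrow> real \<Rightarrow> (real \<Rightarrow> real) \<Rightarrow> bool" where
  "jacob_ladder y0 \<mu> X0 \<phi> \<longleftrightarrow>
     (\<forall>T\<ge>X0. \<phi> T > y0 \<and>
        integral {0..\<mu> (\<phi> T)} (\<lambda>t. (hardy_Z t)\<^sup>2 * exp (- (2 / \<phi> T) * t)) =
        integral {0..T} (\<lambda>t. (hardy_Z t)\<^sup>2))"

definition phi1 :: "(real \<Rightarrow> real) \<Rightarrow> real \<Rightarrow> real" where
  "phi1 \<phi> t = \<phi> t / 2"

text \<open>
  The inverse is taken on the half-line \<open>{X0..}\<close> where \<open>phi1 \<phi>\<close> is increasing; for large \<open>T\<close> the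
  result does not depend on the choice of \<open>X0\<close>.
\<close>
definition rev_iter :: "real \<Rightarrow> (real \<Rightarrow> real) \<Rightarrow> nat \<Rightarrow> real \<Rightarrow> real" where
  "rev_iter X0 \<phi> r T = (inv_into {X0..} (phi1 \<phi>) ^^ r) T"

text \<open>
  \<open>\<alpha> r L U\<close> is used for \<open>0 \<le> r \<le> k\<close> and \<open>\<beta> r L U\<close> for \<open>1 \<le> r \<le> k\<close>; the remaining
  values are irrelevant.
\<close>
definition metamorphosis_relation ::
  "real \<Rightarrow> real \<Rightarrow> nat \<Rightarrow> (nat \<Rightarrow> int \<Rightarrow> real \<Rightarrow> real) \<Rightarrow> (nat \<Rightarrow> int \<Rightarrow> real \<Rightarrow> real) \<Rightarrow> real \<Rightarrow> bool" where
  "metamorphosis_relation a b k \<alpha> \<beta> U \<longleftrightarrow>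
     (\<lambda>L. \<Prod>r = 1..k. \<bar>(rs_sum (\<alpha> r L U) + rs_remainder (\<alpha> r L U)) /
                      (rs_sum (\<beta> r L U) + rs_remainder (\<beta> r L U))\<bar>\<^sup>2)
     \<sim>[at_top]
     (\<lambda>L. arctan (sqrt ((a - b) / (a + b)) * tan (U / 2)) / (sqrt ((a - b) / (a + b)) * (U / 2))
          * ((a + b * cos (\<alpha> 0 L U)) / (a + b)))"

definition control_functions ::
  "real \<Rightarrow> real \<Rightarrow> nat \<Rightarrow> real \<Rightarrow> (real \<Rightarrow> real) \<Rightarrow> real \<Rightarrow>
   (nat \<Rightarrow> int \<Rightarrow> real \<Rightarrow> real) \<Rightarrow> (nat \<Rightarrow> int \<Rightarrow> real \<Rightarrow> real) \<Rightarrow> bool" where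
  "control_functions a b k X0 \<phi> T0 \<alpha> \<beta> \<longleftrightarrow>
     (\<forall>U\<in>{0<..<pi}.
        metamorphosis_relation a b k \<alpha> \<beta> U \<and>
        (\<forall>r<k. (\<lambda>L. \<alpha> (Suc r) L U - \<alpha> r L U) \<sim>[at_top]
                (\<lambda>L. (1 - euler_mascheroni) * prime_count (2 * pi * of_int L))) \<and>
        (\<forall>r\<in>{1..<k}. (\<lambda>L. \<beta> (Suc r) L U - \<beta> r L U) \<sim>[at_top]
                (\<lambda>L. (1 - euler_mascheroni) * prime_count (2 * pi * of_int L)))) \<and>
     (\<forall>U\<in>{0<..<pi}. \<forall>L. of_int L > T0 / (2 * pi) \<longrightarrow>
        (\<forall>r\<in>{0..k}. zeta (Complex (1/2) (\<alpha> r L U)) \<noteq> 0) \<and>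
        (\<forall>r\<in>{1..k}. zeta (Complex (1/2) (\<beta> r L U)) \<noteq> 0) \<and>
        2 * pi * of_int L < \<alpha> 0 L U \<and> (\<forall>r<k. \<alpha> r L U < \<alpha> (Suc r) L U) \<and>
        2 * pi * of_int L < \<beta> 1 L U \<and> (\<forall>r\<in>{1..<k}. \<beta> r L U < \<beta> (Suc r) L U) \<and>
        \<alpha> 0 L U \<in> {2 * pi * of_int L <..< 2 * pi * of_int L + U} \<and>
        (\<forall>r\<in>{1..k}.
           \<alpha> r L U \<in> {rev_iter X0 \<phi> r (2 * pi * of_int L) <..<
                       rev_iter X0 \<phi> r (2 * pi * of_int L + U)} \<and>
           \<beta> r L U \<in> {rev_iter X0 \<phi> r (2 * pi * of_int L) <..<
                       rev_iter X0 \<phi> r (2 * pi * of_int L + U)}))"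

definition control_tuple ::
  "nat \<Rightarrow> (nat \<Rightarrow> int \<Rightarrow> real \<Rightarrow> real) \<Rightarrow> (nat \<Rightarrow> int \<Rightarrow> real \<Rightarrow> real) \<Rightarrow> int \<Rightarrow> real \<Rightarrow> real list" where
  "control_tuple k \<alpha> \<beta> L U =
     map (\<lambda>r. \<alpha> r L U) [0..<Suc k] @ map (\<lambda>r. \<beta> r L U) [1..<Suc k]"

end

theory Submission
  imports Defs
begin

text \<open>
  Metamorphoses are told apart by where their zeroth control value lies: \<open>\<alpha> 0 L U\<close> is in
  \<open>(2 \<pi> L, 2 \<pi> L + U)\<close> with \<open>U < \<pi>\<close>, hence in \<open>(2 \<pi> L, 2 \<pi> (L + 1))\<close>. These intervals are
  disjoint, so \<open>L\<close> can be read off from the first entry of the control tuple as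
  \<open>\<lfloor>\<alpha> 0 L U / (2 \<pi>)\<rfloor>\<close>. For a single fixed \<open>U\<close> the infinitely many integers \<open>L > T0 / (2 \<pi>)\<close>
  therefore give pairwise different tuples.
\<close>

lemma infinite_int_greater_real: "infinite {L::int. real_of_int L > c}"
proof -
  have "{\<lfloor>c\<rfloor> <..} \<subseteq> {L::int. real_of_int L > c}"
    by (auto simp: floor_less_iff)
  then show ?thesis
    using infinite_Ioi infinite_super by blast
qed

lemma hd_control_tuple: "hd (control_tuple k \<alpha> \<beta> L U) = \<alpha> 0 L U"
  by (simp add: control_tuple_def upt_conv_Cons del: upt_Suc)

lemma control_functions_alpha_0:
  assumes "control_functions a b k X0 \<phi> T0 \<alpha> \<beta>"
    and "U \<in> {0<..<pi}" and "real_of_int L > T0 / (2 * pi)"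
  shows "\<alpha> 0 L U \<in> {2 * pi * of_int L <..< 2 * pi * of_int L + U}"
  using assms unfolding control_functions_def by blast

lemma floor_hd_control_tuple:
  assumes "control_functions a b k X0 \<phi> T0 \<alpha> \<beta>"
    and "U \<in> {0<..<pi}" and "real_of_int L > T0 / (2 * pi)"
  shows "\<lfloor>hd (control_tuple k \<alpha> \<beta> L U) / (2 * pi)\<rfloor> = L"
proof -
  have "2 * pi * of_int L < \<alpha> 0 L U" "\<alpha> 0 L U < 2 * pi * of_int L + 2 * pi"
    using control_functions_alpha_0[OF assms] assms(2) by auto
  then show ?thesis
    unfolding hd_control_tuple by (intro floor_unique) (simp_all add: field_simps)
qed

theorem corollary3:
  fixes a b y0 X0 :: real and k :: nat and \<mu> \<phi> :: "real \<Rightarrow> real"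
  assumes "a > \<bar>b\<bar>" and "k \<ge> 1"
    and "admissible y0 \<mu>" and "jacob_ladder y0 \<mu> X0 \<phi>"
  shows "\<forall>\<^sub>F T0 in at_top. \<forall>\<alpha> \<beta>. control_functions a b k X0 \<phi> T0 \<alpha> \<beta> \<longrightarrow>
           infinite {control_tuple k \<alpha> \<beta> L U | L U.
                       real_of_int L > T0 / (2 * pi) \<and> 0 < U \<and> U < pi}"
proof (intro always_eventually allI impI)
  fix T0 :: real and \<alpha> \<beta> :: "nat \<Rightarrow> int \<Rightarrow> real \<Rightarrow> real"
  assume cf: "control_functions a b k X0 \<phi> T0 \<alpha> \<beta>"
  define I where "I = {L::int. real_of_int L > T0 / (2 * pi)}"
  \<comment> \<open>Any fixed element of \<open>(0, \<pi>)\<close> would serve as \<open>U\<close>.\<close>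
  have U: "(1::real) \<in> {0<..<pi}"
    using pi_gt3 by simp
  have "inj_on (\<lambda>L. control_tuple k \<alpha> \<beta> L 1) I"
    by (rule inj_on_inverseI[where g = "\<lambda>xs. \<lfloor>hd xs / (2 * pi)\<rfloor>"])
       (use floor_hd_control_tuple[OF cf U] in \<open>auto simp: I_def\<close>)
  moreover have "infinite I"
    unfolding I_def by (rule infinite_int_greater_real)
  ultimately have "infinite ((\<lambda>L. control_tuple k \<alpha> \<beta> L 1) ` I)"
    by (simp add: finite_image_iff)
  moreover have "(\<lambda>L. control_tuple k \<alpha> \<beta> L 1) ` I \<subseteq>
      {control_tuple k \<alpha> \<beta> L U | L U. real_of_int L > T0 / (2 * pi) \<and> 0 < U \<and> U < pi}"
    using U unfolding I_def by fastforce
  ultimately show "infinite {control_tuple k \<alpha> \<beta> L U | L U.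
      real_of_int L > T0 / (2 * pi) \<and> 0 < U \<and> U < pi}"
    using infinite_super by blast
qed

end
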